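(* Consider the robust peak load pricing model with elastic demand and uncertain variable costs (defined in the context). For any $\eta>0$ there exist instances of the model such that $C'_R>\eta\,E'_R$.
   Context: Let $\mathcal{N}=\{1,\dots,N\}$ (producers) and $\mathcal{T}=\{1,\dots,T\}$ (time periods). An instance consists of: investment costs $c^{\mathrm{inv}}_i\ge 0$, nominal variable costs $c^{\mathrm{var}}_i\ge 0$, scaling factors $a_i\ge 0$ ($i\in\mathcal{N}$), strictly decreasing demand functions $p_t:\mathbb{R}\to\mathbb{R}$ ($t\in\mathcal{T}$), and an uncertainty set $\mathcal{U}\subseteq[0,1]^{N\times T}$ which is a convex polytope with $0\in\mathcal{U}$, whose projection onto every coordinate axis is $[0,1]$, and which is a Cartesian product $\mathcal{U}=\prod_{t\in\mathcal{T}}\mathcal{U}'$ for some $\mathcal{U}'\subseteq[0,1]^N$. The uncertain variable costs are $c^{\mathrm{var}}_i+a_iu_{i,t}$, $u\in\mathcal{U}$. Feasible set: $F=\{(x,y)\in\mathbb{R}^{N\times T}_{\ge 0}\times\mathbb{R}^N_{\ge 0} : x_{i,t}\le y_i\ \forall i,t\}$. Write $\bar x_t=\sum_{i\in\mathcal{N}}x_{i,t}$ and $$W(x,y,u)=\sum_{t\in\mathcal{T}}\int_0^{\bar x_t}p_t(s)\,ds-\sum_{i\in\mathcal{N}}\Big(c^{\mathrm{inv}}_iy_i+\sum_{t\in\mathcal{T}}(c^{\mathrm{var}}_i+a_iu_{i,t})x_{i,t}\Big).$$ Robust market equilibrium: an optimal solution $(x^*,y^* )$ of $\max_{(x,y)\in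 F}W(x,y,e)$, where $e$ is the all-ones vector (every producer uses its own worst-case cost $c^{\mathrm{var}}_i+a_i$). Its worst-case welfare is $E'_R:=\min_{u\in\mathcal{U}}W(x^*,y^*,u)$. Robust central planner: $C'_R:=\max_{(x,y)\in F}\min_{u\in\mathcal{U}}W(x,y,u)$. *)

theory Defs
  imports "HOL-Analysis.Analysis" "HOL-Analysis.Finite_Function_Topology"
begin

(* R^I for a finite index set I is modelled inside the real normed vector space of finitely
   supported functions, as the subspace of vectors supported in I.  The dimensions N and T
   can thus be quantified over, and the library's polytope (a convex hull of finitely
   many points) applies as it stands. *)
definition coord_space :: "'i set \<Rightarrow> ('i \<Rightarrow>\<^sub>0 real) set" where
  "coord_space I = {v. Poly_Mapping.keys v \<subseteq> I}"

definition nonneg_orthant :: "'i set \<Rightarrow> ('i \<Rightarrow>\<^sub>0 real) set" where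
  "nonneg_orthant I = {v \<in> coord_space I. \<forall>k\<in>I. 0 \<le> Poly_Mapping.lookup v k}"

definition unit_cube :: "'i set \<Rightarrow> ('i \<Rightarrow>\<^sub>0 real) set" where
  "unit_cube I = {v \<in> coord_space I. \<forall>k\<in>I. Poly_Mapping.lookup v k \<in> {0..1}}"

definition all_ones :: "'i set \<Rightarrow> ('i \<Rightarrow>\<^sub>0 real)" where
  "all_ones I = (\<Sum>k\<in>I. Poly_Mapping.single k 1)"

(* The function i \<mapsto> u (i, t).  (Poly_Mapping.map_key f v is v \<circ> f for injective f.) *)
definition period_slice :: "nat \<Rightarrow> (nat \<times> nat \<Rightarrow>\<^sub>0 real) \<Rightarrow> (nat \<Rightarrow>\<^sub>0 real)" where
  "period_slice t u = Poly_Mapping.map_key (\<lambda>i. (i, t)) u"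

(* Only the values of the cost and demand functions on the producers 1..N and the
   periods 1..T matter. *)
record plp =
  num_producers :: nat
  num_periods :: nat
  inv_cost :: "nat \<Rightarrow> real"
  var_cost :: "nat \<Rightarrow> real"
  scaling :: "nat \<Rightarrow> real"
  demand :: "nat \<Rightarrow> real \<Rightarrow> real"
  uncertainty :: "(nat \<times> nat \<Rightarrow>\<^sub>0 real) set"

definition producers :: "plp \<Rightarrow> nat set" where
  "producers m = {1..num_producers m}"

definition periods :: "plp \<Rightarrow> nat set" where
  "periods m = {1..num_periods m}"

definition valid_uncertainty_set :: "plp \<Rightarrow> bool" where
  "valid_uncertainty_set m \<longleftrightarrow>
     uncertainty m \<subseteq> unit_cube (producers m \<times> periods m) \<and>
     polytope (uncertainty m) \<and>
     0 \<in> uncertainty m \<and>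
     (\<forall>i\<in>producers m. \<forall>t\<in>periods m.
        (\<lambda>u. Poly_Mapping.lookup u (i, t)) ` uncertainty m = {0..1}) \<and>
     (\<exists>U' \<subseteq> unit_cube (producers m).
        uncertainty m =
          {u \<in> coord_space (producers m \<times> periods m). \<forall>t\<in>periods m. period_slice t u \<in> U'})"

definition plp_instance :: "plp \<Rightarrow> bool" where
  "plp_instance m \<longleftrightarrow>
     1 \<le> num_producers m \<and> 1 \<le> num_periods m \<and>
     (\<forall>i\<in>producers m. 0 \<le> inv_cost m i \<and> 0 \<le> var_cost m i \<and> 0 \<le> scaling m i) \<and>
     (\<forall>t\<in>periods m. strict_antimono_on UNIV (demand m t)) \<and>
     valid_uncertainty_set m"

type_synonym plan = "(nat \<times> nat \<Rightarrow>\<^sub>0 real) \<times> (nat \<Rightarrow>\<^sub>0 real)"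

definition feasible :: "plp \<Rightarrow> plan set" where
  "feasible m = {(x, y).
     x \<in> nonneg_orthant (producers m \<times> periods m) \<and> y \<in> nonneg_orthant (producers m) \<and>
     (\<forall>i\<in>producers m. \<forall>t\<in>periods m. Poly_Mapping.lookup x (i, t) \<le> Poly_Mapping.lookup y i)}"

definition total_production :: "plp \<Rightarrow> (nat \<times> nat \<Rightarrow>\<^sub>0 real) \<Rightarrow> nat \<Rightarrow> real" where
  "total_production m x t = (\<Sum>i\<in>producers m. Poly_Mapping.lookup x (i, t))"

(* On feasible plans the upper limit of integration is nonnegative, and the decreasing
   demand function is integrable on the interval. *)
definition welfare :: "plp \<Rightarrow> plan \<Rightarrow> (nat \<times> nat \<Rightarrow>\<^sub>0 real) \<Rightarrow> real" where
  "welfare m = (\<lambda>(x, y) u.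
     (\<Sum>t\<in>periods m. integral {0..total_production m x t} (demand m t))
     - (\<Sum>i\<in>producers m. inv_cost m i * Poly_Mapping.lookup y i
          + (\<Sum>t\<in>periods m.
               (var_cost m i + scaling m i * Poly_Mapping.lookup u (i, t))
                 * Poly_Mapping.lookup x (i, t))))"

(* This infimum is a minimum; see worst_case_welfare_attained. *)
definition worst_case_welfare :: "plp \<Rightarrow> plan \<Rightarrow> real" where
  "worst_case_welfare m z = (INF u\<in>uncertainty m. welfare m z u)"

(* Every producer hedges against its own worst-case cost, so the all-ones vector is
   used here whether or not it belongs to the uncertainty set. *)
definition robust_equilibrium :: "plp \<Rightarrow> plan \<Rightarrow> bool" where
  "robust_equilibrium m z \<longleftrightarrow>
     is_arg_max (\<lambda>z. welfare m z (all_ones (producers m \<times> periods m))) (\<lambda>z. z \<in> feasible m) z"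

definition robust_planner_optimum :: "plp \<Rightarrow> plan \<Rightarrow> bool" where
  "robust_planner_optimum m z \<longleftrightarrow> is_arg_max (worst_case_welfare m) (\<lambda>z. z \<in> feasible m) z"

(* Meaningful, and then equal to the maximum, when a robust_planner_optimum exists. *)
definition planner_value :: "plp \<Rightarrow> real" where
  "planner_value m = (SUP z\<in>feasible m. worst_case_welfare m z)"

lemma lookup_scaleR_pm:
  "Poly_Mapping.lookup (c *\<^sub>R u) k = c * Poly_Mapping.lookup (u :: 'i \<Rightarrow>\<^sub>0 real) k"
proof -
  have "finite {i. Poly_Mapping.lookup u i \<noteq> 0}"
    using finite_lookup .
  then have "finite {i. c *\<^sub>R Poly_Mapping.lookup u i \<noteq> 0}"
    by (rule rev_finite_subset) auto
  then show ?thesis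
    by (simp add: scaleR_poly_mapping_def)
qed

lemma welfare_affine:
  assumes "a + b = 1"
  shows "welfare m z (a *\<^sub>R u + b *\<^sub>R v) = a * welfare m z u + b * welfare m z v"
proof -
  obtain x y where z: "z = (x, y)" by (cases z)
  define A where "A = (\<Sum>t\<in>periods m. integral {0..total_production m x t} (demand m t))
     - (\<Sum>i\<in>producers m. inv_cost m i * Poly_Mapping.lookup y i)
     - (\<Sum>i\<in>producers m. \<Sum>t\<in>periods m. var_cost m i * Poly_Mapping.lookup x (i, t))"
  define L where "L u = (\<Sum>i\<in>producers m. \<Sum>t\<in>periods m.
      scaling m i * Poly_Mapping.lookup u (i, t) * Poly_Mapping.lookup x (i, t))" for u
  have W: "welfare m z u = A - L u" for u
    by (simp add: welfare_def z A_def L_def sum.distrib distrib_right algebra_simps)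
  have L: "L (a *\<^sub>R u + b *\<^sub>R v) = a * L u + b * L v"
    by (simp add: L_def lookup_add lookup_scaleR_pm sum_distrib_left algebra_simps sum.distrib)
  have "A = a * A + b * A"
    using assms by (metis distrib_right mult_1)
  then show ?thesis
    unfolding W L by (simp add: algebra_simps)
qed

lemma worst_case_welfare_attained:
  assumes "plp_instance m"
  shows "\<exists>u\<in>uncertainty m. worst_case_welfare m z = welfare m z u \<and>
           (\<forall>v\<in>uncertainty m. welfare m z u \<le> welfare m z v)"
proof -
  obtain V where V: "finite V" "uncertainty m = convex hull V" and 0: "0 \<in> uncertainty m"
    using assms unfolding plp_instance_def valid_uncertainty_set_def polytope_def by blast
  then have "V \<noteq> {}" by auto
  then obtain u where u: "u \<in> V" "\<And>v. v \<in> V \<Longrightarrow> welfare m z u \<le> welfare m z v"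
    using V(1) by (metis arg_min_least arg_min_if_finite(1))
  have "convex {v. welfare m z u \<le> welfare m z v}"
  proof (rule convexI)
    fix v w :: "nat \<times> nat \<Rightarrow>\<^sub>0 real" and a b :: real
    assume "v \<in> {v. welfare m z u \<le> welfare m z v}" "w \<in> {v. welfare m z u \<le> welfare m z v}"
      and ab: "0 \<le> a" "0 \<le> b" "a + b = 1"
    then have "a * welfare m z u + b * welfare m z u \<le> a * welfare m z v + b * welfare m z w"
      by (intro add_mono mult_left_mono) auto
    moreover have "a * welfare m z u + b * welfare m z u = welfare m z u"
      using ab by (metis distrib_right mult_1)
    ultimately show "a *\<^sub>R v + b *\<^sub>R w \<in> {v. welfare m z u \<le> welfare m z v}"
      using welfare_affine[OF ab(3)] by simp
  qed
  then have "uncertainty m \<subseteq> {v. welfare m z u \<le> welfare m z v}"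
    unfolding V(2) using u(2) by (intro hull_minimal) auto
  then have least: "\<forall>v\<in>uncertainty m. welfare m z u \<le> welfare m z v" by auto
  have mem: "u \<in> uncertainty m"
    using u(1) V(2) hull_inc by metis
  have "worst_case_welfare m z = welfare m z u"
    unfolding worst_case_welfare_def
    by (rule cInf_eq_minimum) (use mem least in auto)
  with mem least show ?thesis by blast
qed

lemma planner_value_eq_maximum:
  assumes "robust_planner_optimum m z"
  shows "planner_value m = worst_case_welfare m z"
  unfolding planner_value_def
  by (rule cSup_eq_maximum)
     (use assms in \<open>auto simp: robust_planner_optimum_def is_arg_max_linorder\<close>)

end

theory Submission
  imports Defs
begin

text \<open>
  Two producers, one period, no investment or nominal variable costs, unit scaling factors, demand
  \<open>1 - s\<close>, and the budgeted uncertainty set \<open>{u \<ge> 0. u\<^sub>1 + u\<^sub>2 \<le> 1}\<close>. If every producer hedges against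
  unit cost, the welfare of total production \<open>X\<close> is \<open>- X\<^sup>2 / 2\<close>, so nothing is produced in
  equilibrium. The planner knows that the two costs cannot both be \<open>1\<close>: splitting production
  evenly halves the worst-case cost, which leaves the welfare \<open>X / 2 - X\<^sup>2 / 2\<close>, with maximum \<open>1 / 8\<close> at
  \<open>X = 1 / 2\<close>. As the equilibrium welfare is \<open>0\<close>, this one instance serves every \<open>\<eta>\<close>.
\<close>

text \<open>The budgeted set is a polytope because each point of the triangle is a convex
  combination of the vertices: its own coordinates weight the two unit vectors, and the origin takes
  the rest.\<close>

lemma convex_hull_zero_two_singles:
  fixes a b :: 'i
  assumes "a \<noteq> b"
  shows "convex hull {0, Poly_Mapping.single a 1, Poly_Mapping.single b (1::real)} =
    {u \<in> coord_space {a, b}. 0 \<le> Poly_Mapping.lookup u a \<and> 0 \<le> Poly_Mapping.lookup u b \<and>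
       Poly_Mapping.lookup u a + Poly_Mapping.lookup u b \<le> 1}" (is "?H = ?S")
proof
  show "?H \<subseteq> ?S"
    using assms
    by (auto simp: convex_hull_3 coord_space_def lookup_add lookup_scaleR_pm lookup_single when_def
        in_keys_iff split: if_splits)
  show "?S \<subseteq> ?H"
  proof
    fix u assume u: "u \<in> ?S"
    let ?p = "Poly_Mapping.lookup u a" and ?q = "Poly_Mapping.lookup u b"
    have "u = (1 - ?p - ?q) *\<^sub>R 0 + ?p *\<^sub>R Poly_Mapping.single a 1 + ?q *\<^sub>R Poly_Mapping.single b 1"
      using u assms
      by (intro poly_mapping_eqI)
         (auto simp: coord_space_def lookup_add lookup_scaleR_pm lookup_single when_def in_keys_iff)
    moreover have "0 \<le> 1 - ?p - ?q" "0 \<le> ?p" "0 \<le> ?q" "(1 - ?p - ?q) + ?p + ?q = 1"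
      using u by auto
    ultimately show "u \<in> ?H"
      unfolding convex_hull_3 by blast
  qed
qed

definition budget_instance :: plp where
  "budget_instance = \<lparr>num_producers = 2, num_periods = 1, inv_cost = (\<lambda>_. 0), var_cost = (\<lambda>_. 0),
     scaling = (\<lambda>_. 1), demand = (\<lambda>_ s. 1 - s),
     uncertainty = {u \<in> coord_space {(1, 1), (2, 1)}.
       0 \<le> Poly_Mapping.lookup u (1, 1) \<and> 0 \<le> Poly_Mapping.lookup u (2, 1) \<and>
       Poly_Mapping.lookup u (1, 1) + Poly_Mapping.lookup u (2, 1) \<le> 1}\<rparr>"

lemma producers_budget_instance [simp]: "producers budget_instance = {1, 2}"
  by (auto simp: producers_def budget_instance_def)

lemma periods_budget_instance [simp]: "periods budget_instance = {1}"
  by (simp add: periods_def budget_instance_def)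

lemma uncertainty_budget_instance:
  "uncertainty budget_instance = {u \<in> coord_space {(1, 1), (2, 1)}.
     0 \<le> Poly_Mapping.lookup u (1, 1) \<and> 0 \<le> Poly_Mapping.lookup u (2, 1) \<and>
     Poly_Mapping.lookup u (1, 1) + Poly_Mapping.lookup u (2, 1) \<le> 1}"
  by (simp add: budget_instance_def)

lemma lookup_period_slice:
  "Poly_Mapping.lookup (period_slice t u) i = Poly_Mapping.lookup u (i, t)"
  by (simp add: period_slice_def map_key.rep_eq inj_def)

lemma single_mem_uncertainty_budget_instance:
  assumes "k = (1, 1) \<or> k = (2, 1)" "c \<in> {0..1}"
  shows "Poly_Mapping.single k c \<in> uncertainty budget_instance"
  using assms
  by (auto simp: uncertainty_budget_instance coord_space_def lookup_single when_def
      split: if_splits)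

lemma plp_instance_budget_instance: "plp_instance budget_instance"
proof -
  let ?U = "uncertainty budget_instance"
  let ?U' = "{v \<in> coord_space {1, 2::nat}. 0 \<le> Poly_Mapping.lookup v 1 \<and>
      0 \<le> Poly_Mapping.lookup v 2 \<and> Poly_Mapping.lookup v 1 + Poly_Mapping.lookup v 2 \<le> (1::real)}"
  have prod: "{1, 2} \<times> {1} = {(1, 1), (2::nat, 1::nat)}"
    by auto
  have "polytope ?U"
    unfolding polytope_def uncertainty_budget_instance
    using convex_hull_zero_two_singles[of "(1::nat, 1::nat)" "(2, 1)"]
    by (intro exI[of _ "{0, Poly_Mapping.single (1, 1) 1, Poly_Mapping.single (2, 1) 1}"]) auto
  moreover have "(\<lambda>u. Poly_Mapping.lookup u k) ` ?U = {0..1}"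
    if k: "k = (1, 1) \<or> k = (2, 1)" for k
  proof
    show "(\<lambda>u. Poly_Mapping.lookup u k) ` ?U \<subseteq> {0..1}"
      using k by (auto simp: uncertainty_budget_instance)
    \<comment> \<open>Both unit segments on the axes lie in the budgeted set, so each value is
      attained on the axis of \<open>k\<close>.\<close>
    show "{0..1} \<subseteq> (\<lambda>u. Poly_Mapping.lookup u k) ` ?U"
      using single_mem_uncertainty_budget_instance[OF k] by (force intro: rev_image_eqI)
  qed
  \<comment> \<open>With one period the product has a single factor: the same triangle, indexed by
    producers alone.\<close>
  moreover have "?U = {u \<in> coord_space ({1, 2} \<times> {1}). period_slice 1 u \<in> ?U'}"
  proof -
    have "period_slice 1 u \<in> coord_space {1, 2}" if "u \<in> coord_space {(1, 1), (2, 1)}" for u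
      using that by (force simp: coord_space_def in_keys_iff lookup_period_slice)
    then show ?thesis
      unfolding prod by (auto simp: uncertainty_budget_instance lookup_period_slice)
  qed
  moreover have "?U' \<subseteq> unit_cube {1, 2}"
    by (auto simp: unit_cube_def)
  moreover have "?U \<subseteq> unit_cube ({1, 2} \<times> {1})"
    unfolding prod by (auto simp: unit_cube_def uncertainty_budget_instance)
  moreover have "0 \<in> ?U"
    by (simp add: uncertainty_budget_instance coord_space_def)
  ultimately have "valid_uncertainty_set budget_instance"
    unfolding valid_uncertainty_set_def
    by (intro conjI exI[of _ ?U']) auto
  then show ?thesis
    unfolding plp_instance_def
    by (simp add: budget_instance_def monotone_on_def)
qed

text \<open>Capacity is free, so \<open>y\<close> drops out. Feasibility gives
  \<open>0 \<le> p + q\<close>, so the integral can be read off the antiderivative s -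
  s^2/2.\<close>

lemma welfare_budget_instance:
  assumes "(x, y) \<in> feasible budget_instance"
  defines "p \<equiv> Poly_Mapping.lookup x (1, 1)" and "q \<equiv> Poly_Mapping.lookup x (2, 1)"
  shows "0 \<le> p" "0 \<le> q"
    "welfare budget_instance (x, y) u = (p + q) - (p + q)\<^sup>2 / 2
       - (Poly_Mapping.lookup u (1, 1) * p + Poly_Mapping.lookup u (2, 1) * q)"
proof -
  show pq: "0 \<le> p" "0 \<le> q"
    using assms(1) by (auto simp: feasible_def nonneg_orthant_def p_def q_def)
  have "((\<lambda>s. 1 - s) has_integral ((p + q) - (p + q)\<^sup>2 / 2) - (0 - 0\<^sup>2 / 2)) {0..p + q}"
    using pq
    by (intro fundamental_theorem_of_calculus)
       (auto intro!: derivative_eq_intros simp flip: has_real_derivative_iff_has_vector_derivative)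
  then have "integral {0..p + q} (\<lambda>s. 1 - s) = (p + q) - (p + q)\<^sup>2 / 2"
    by (simp add: integral_unique)
  moreover have "demand budget_instance 1 = (\<lambda>s. 1 - s)" "inv_cost budget_instance i = 0"
    "var_cost budget_instance i = 0" "scaling budget_instance i = 1" for i
    by (simp_all add: budget_instance_def)
  ultimately show "welfare budget_instance (x, y) u = (p + q) - (p + q)\<^sup>2 / 2
       - (Poly_Mapping.lookup u (1, 1) * p + Poly_Mapping.lookup u (2, 1) * q)"
    by (simp add: welfare_def total_production_def p_def q_def)
qed

text \<open>Unit costs cancel the linear part of the surplus. The all-ones vector has coordinate sum
  2 and lies outside the budgeted set, which is the source of the gap.\<close>

lemma welfare_all_ones_budget_instance:
  assumes "(x, y) \<in> feasible budget_instance"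
  shows "welfare budget_instance (x, y)
      (all_ones (producers budget_instance \<times> periods budget_instance)) =
    - (Poly_Mapping.lookup x (1, 1) + Poly_Mapping.lookup x (2, 1))\<^sup>2 / 2"
proof -
  have "{1, 2} \<times> {1} = {(1, 1), (2::nat, 1::nat)}"
    by auto
  then show ?thesis
    by (simp add: welfare_budget_instance(3)[OF assms] all_ones_def lookup_add lookup_single)
qed

lemma zero_feasible_budget_instance: "(0, 0) \<in> feasible budget_instance"
  by (simp add: feasible_def nonneg_orthant_def coord_space_def)

lemma robust_equilibrium_zero: "robust_equilibrium budget_instance (0, 0)"
  unfolding robust_equilibrium_def is_arg_max_linorder
  using zero_feasible_budget_instance
  by (auto simp: welfare_all_ones_budget_instance
      simp del: producers_budget_instance periods_budget_instance)

text \<open>Equilibria are not unique, as capacity is free, but comparison with the zero plan forces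
  production to vanish in each of them; the welfare is then 0 in every scenario.\<close>

lemma worst_case_welfare_equilibrium:
  assumes "robust_equilibrium budget_instance z"
  shows "worst_case_welfare budget_instance z = 0"
proof -
  obtain x y where z: "z = (x, y)" by (cases z)
  let ?e = "all_ones (producers budget_instance \<times> periods budget_instance)"
  have feas: "(x, y) \<in> feasible budget_instance"
    and max: "welfare budget_instance (0, 0) ?e \<le> welfare budget_instance (x, y) ?e"
    using assms zero_feasible_budget_instance
    by (auto simp: robust_equilibrium_def is_arg_max_linorder z)
  from max have "(Poly_Mapping.lookup x (1, 1) + Poly_Mapping.lookup x (2, 1))\<^sup>2 \<le> 0"
    unfolding welfare_all_ones_budget_instance[OF feas]
      welfare_all_ones_budget_instance[OF zero_feasible_budget_instance] by simp
  then have "Poly_Mapping.lookup x (1, 1) = 0" "Poly_Mapping.lookup x (2, 1) = 0"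
    using welfare_budget_instance(1,2)[OF feas] by auto
  then have "welfare budget_instance z u = 0" for u
    unfolding z welfare_budget_instance(3)[OF feas] by simp
  then show ?thesis
    using worst_case_welfare_attained[OF plp_instance_budget_instance, of z] by auto
qed

text \<open>Two scenarios suffice: the whole budget falls on one producer or on the other. Averaging
  the two bounds leaves one that depends only on the total \<open>p + q\<close>, not on how it is
  split.\<close>

lemma worst_case_welfare_budget_instance_le:
  assumes "z \<in> feasible budget_instance"
  shows "worst_case_welfare budget_instance z \<le> 1 / 8"
proof -
  obtain x y where z: "z = (x, y)" by (cases z)
  define p where "p = Poly_Mapping.lookup x (1, 1)"
  define q where "q = Poly_Mapping.lookup x (2, 1)"
  have W: "welfare budget_instance z u = (p + q) - (p + q)\<^sup>2 / 2
       - (Poly_Mapping.lookup u (1, 1) * p + Poly_Mapping.lookup u (2, 1) * q)" for u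
    using welfare_budget_instance(3) assms unfolding z p_def q_def by blast
  have le: "worst_case_welfare budget_instance z \<le> welfare budget_instance z u"
    if "u \<in> uncertainty budget_instance" for u
    using worst_case_welfare_attained[OF plp_instance_budget_instance, of z] that by auto
  have "worst_case_welfare budget_instance z \<le> (p + q) - (p + q)\<^sup>2 / 2 - p"
    using le[OF single_mem_uncertainty_budget_instance[of "(1, 1)" 1]]
    by (simp add: W lookup_single)
  moreover have "worst_case_welfare budget_instance z \<le> (p + q) - (p + q)\<^sup>2 / 2 - q"
    using le[OF single_mem_uncertainty_budget_instance[of "(2, 1)" 1]]
    by (simp add: W lookup_single)
  ultimately have "worst_case_welfare budget_instance z \<le> (p + q) / 2 - (p + q)\<^sup>2 / 2"
    by (simp add: field_simps)
  also have "\<dots> = 1 / 8 - (p + q - 1 / 2)\<^sup>2 / 2"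
    by (simp add: power2_eq_square field_simps)
  finally show ?thesis
    using zero_le_power2[of "p + q - 1 / 2"] by linarith
qed

text \<open>The upper bound 1/8 is reached only at total production 1/2, and equal shares make both
  extreme scenarios equally costly.\<close>

definition even_split :: plan where
  "even_split =
     (Poly_Mapping.single (1, 1) (1 / 4) + Poly_Mapping.single (2, 1) (1 / 4),
      Poly_Mapping.single 1 (1 / 4) + Poly_Mapping.single 2 (1 / 4))"

lemma even_split_feasible: "even_split \<in> feasible budget_instance"
  by (auto simp: even_split_def feasible_def nonneg_orthant_def coord_space_def lookup_add
      lookup_single when_def in_keys_iff split: if_splits)

lemma worst_case_welfare_even_split: "1 / 8 \<le> worst_case_welfare budget_instance even_split"
proof -
  obtain u where u: "u \<in> uncertainty budget_instance"
    and W: "worst_case_welfare budget_instance even_split = welfare budget_instance even_split u"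
    using worst_case_welfare_attained[OF plp_instance_budget_instance] by blast
  note W
  \<comment> \<open>Equal shares make the cost depend on \<open>u\<close> only through its
    coordinate sum, which is at most 1. The constant is the surplus 1/2 - (1/2)^2/2.\<close>
  also have "welfare budget_instance even_split u = 3 / 8 - (Poly_Mapping.lookup u (1, 1) + Poly_Mapping.lookup u (2, 1)) / 4"
    using even_split_feasible unfolding even_split_def
    by (subst welfare_budget_instance(3))
       (simp_all add: lookup_add lookup_single power2_eq_square field_simps)
  finally show ?thesis
    using u by (simp add: uncertainty_budget_instance)
qed

text \<open>The two bounds meet at 1/8, so the supremum in \<open>planner_value\<close> is an
  attained maximum.\<close>

lemma robust_planner_optimum_even_split: "robust_planner_optimum budget_instance even_split"
  unfolding robust_planner_optimum_def is_arg_max_linorder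
  using even_split_feasible worst_case_welfare_even_split worst_case_welfare_budget_instance_le
  by (blast intro: order_trans)

theorem theorem5p1:
  fixes \<eta> :: real
  assumes "\<eta> > 0"
  shows "\<exists>m. plp_instance m \<and>
           (\<exists>z. robust_equilibrium m z) \<and>
           (\<exists>z. robust_planner_optimum m z) \<and>
           (\<forall>z. robust_equilibrium m z \<longrightarrow> planner_value m > \<eta> * worst_case_welfare m z)"
proof -
  \<comment> \<open>Every equilibrium has worst-case welfare 0, so positivity settles the claim for
    each \<eta>.\<close>
  have "0 < planner_value budget_instance"
    using planner_value_eq_maximum[OF robust_planner_optimum_even_split]
      worst_case_welfare_even_split by simp
  then show ?thesis
    using plp_instance_budget_instance robust_equilibrium_zero robust_planner_optimum_even_split
    by (intro exI[of _ budget_instance] conjI allI impI)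
       (blast | simp add: worst_case_welfare_equilibrium)+
qed

end
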